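(* Let $X$ be a graph of order $n$ that recognizes vertices. The following are equivalent: (1) $X$ is a stable graph, i.e. $\tilde X\approx X$; (2) $X\approx X^2$; (3) $X\approx X^\ell$ for all integers $\ell>1$.
   Context: Labels are independent commuting indeterminates $x_0,x_1,\dots$; $\mathrm{Var}=\{x_1,x_2,\dots\}$. A graph of order $n$ is a symmetric $n\times n$ matrix over $\{x_0\}\cup\mathrm{Var}$. Matrix products and powers ($X^0=I$) are computed in the commutative polynomial ring over $\mathbb{R}$ in these indeterminates and an extra indeterminate $\lambda$. For matrices $A=(a_{ij}),B=(b_{ij})$ of the same order, $A\rightarrowtail B$ means $b_{ij}=b_{st}\Rightarrow a_{ij}=a_{st}$ for all $i,j,s,t$, and $A\approx B$ means $A\rightarrowtail B$ and $B\rightarrowtail A$. An equivalent variable substitution to a matrix replaces its entries by variables of $\mathrm{Var}$, equal entries by equal variables and distinct entries by distinct variables. The description graph $\tilde X$ of a graph $X$ of order $n$ is a graph obtained by an equivalent variable substitution from $\Gamma(X)=\sum_{k=0}^{n-1}\lambda^kX^k$. A graph recognizes vertices if none of its diagonal entries equals an off-diagonal entry. *)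

theory Defs
  imports "Jordan_Normal_Form.Matrix" "HOL-Library.Poly_Mapping"
begin

text \<open>The indeterminates are the labels \<open>x\<^sub>0, x\<^sub>1, \<dots>\<close> and the extra indeterminate
  \<open>\<lambda>\<close>. A polynomial maps finitely many monomials to nonzero real coefficients, and a monomial
  maps finitely many indeterminates to nonzero exponents.\<close>

datatype indet = Label nat | Lambda

type_synonym rpoly = "(indet \<Rightarrow>\<^sub>0 nat) \<Rightarrow>\<^sub>0 real"

definition indet_poly :: "indet \<Rightarrow> rpoly" where
  "indet_poly v = Poly_Mapping.single (Poly_Mapping.single v 1) 1"

definition label :: "nat \<Rightarrow> rpoly" where
  "label k = indet_poly (Label k)"

definition lam :: rpoly where
  "lam = indet_poly Lambda"

definition Var :: "rpoly set" where
  "Var = label ` {1..}"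

definition label_graph :: "nat \<Rightarrow> rpoly mat \<Rightarrow> bool" where
  "label_graph n X \<longleftrightarrow> X \<in> carrier_mat n n \<and> X\<^sup>T = X \<and>
     (\<forall>i<n. \<forall>j<n. X $$ (i, j) \<in> {label 0} \<union> Var)"

definition recognizes_vertices :: "rpoly mat \<Rightarrow> bool" where
  "recognizes_vertices X \<longleftrightarrow>
     (\<forall>i<dim_row X. \<forall>j<dim_row X. \<forall>k<dim_col X. j \<noteq> k \<longrightarrow> X $$ (i, i) \<noteq> X $$ (j, k))"

definition mat_arrow :: "'a mat \<Rightarrow> 'b mat \<Rightarrow> bool" (infix \<open>\<rightarrowtail>\<close> 50) where
  "A \<rightarrowtail> B \<longleftrightarrow> dim_row A = dim_row B \<and> dim_col A = dim_col B \<and>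
     (\<forall>i<dim_row A. \<forall>j<dim_col A. \<forall>s<dim_row A. \<forall>t<dim_col A.
        B $$ (i, j) = B $$ (s, t) \<longrightarrow> A $$ (i, j) = A $$ (s, t))"

definition mat_equiv :: "'a mat \<Rightarrow> 'b mat \<Rightarrow> bool" (infix \<open>\<approx>\<close> 50) where
  "A \<approx> B \<longleftrightarrow> A \<rightarrowtail> B \<and> B \<rightarrowtail> A"

text \<open>\<open>equiv_var_subst A B\<close>: the matrix \<open>B\<close> is a possible result of an equivalent variable
  substitution to \<open>A\<close>.\<close>

definition equiv_var_subst :: "rpoly mat \<Rightarrow> rpoly mat \<Rightarrow> bool" where
  "equiv_var_subst A B \<longleftrightarrow> dim_row B = dim_row A \<and> dim_col B = dim_col A \<and>
     (\<exists>\<sigma>. inj_on \<sigma> (elements_mat A) \<and> \<sigma> ` elements_mat A \<subseteq> Var \<and>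
        (\<forall>i<dim_row A. \<forall>j<dim_col A. B $$ (i, j) = \<sigma> (A $$ (i, j))))"

definition Gamma :: "nat \<Rightarrow> rpoly mat \<Rightarrow> rpoly mat" where
  "Gamma n X = mat n n (\<lambda>(i, j). \<Sum>k<n. (lam ^ k \<cdot>\<^sub>m X ^\<^sub>m k) $$ (i, j))"

definition description_graph :: "nat \<Rightarrow> rpoly mat \<Rightarrow> rpoly mat \<Rightarrow> bool" where
  "description_graph n X Y \<longleftrightarrow> label_graph n Y \<and> equiv_var_subst (Gamma n X) Y"

text \<open>A description graph is determined only up to the choice of variables. The lemmas
  \<open>description_graph_exists\<close> and \<open>stable_graph_iff\<close> below show that this choice does not affect
  stability.\<close>

definition stable_graph :: "nat \<Rightarrow> rpoly mat \<Rightarrow> bool" where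
  "stable_graph n X \<longleftrightarrow> (\<exists>Y. description_graph n X Y \<and> Y \<approx> X)"

lemma single_eq_iff:
  assumes "c \<noteq> 0"
  shows "Poly_Mapping.single a c = Poly_Mapping.single b c \<longleftrightarrow> a = b"
  using assms by (metis lookup_single_eq lookup_single_not_eq)

lemma label_eq_iff [simp]: "label k = label l \<longleftrightarrow> k = l"
  by (simp add: label_def indet_poly_def single_eq_iff)

lemma pow_mat_commute:
  assumes "(X :: 'a :: semiring_1 mat) \<in> carrier_mat n n"
  shows "X * X ^\<^sub>m k = X ^\<^sub>m k * X"
proof (induction k)
  case 0
  then show ?case using assms by simp
next
  case (Suc k)
  have "X * (X ^\<^sub>m k * X) = X * X ^\<^sub>m k * X"
    using assms by (intro assoc_mult_mat[symmetric, of _ n n _ n _ n]) auto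
  then show ?case using Suc by simp
qed

lemma transpose_pow_mat:
  assumes "(X :: 'a :: comm_semiring_1 mat) \<in> carrier_mat n n" "X\<^sup>T = X"
  shows "(X ^\<^sub>m k)\<^sup>T = X ^\<^sub>m k"
proof (induction k)
  case 0
  then show ?case by simp
next
  case (Suc k)
  have "(X ^\<^sub>m k * X)\<^sup>T = X\<^sup>T * (X ^\<^sub>m k)\<^sup>T"
    using assms by (intro transpose_mult[of _ n n _ n]) auto
  then show ?case using Suc assms pow_mat_commute[of X n k] by simp
qed

lemma description_graph_exists:
  assumes "label_graph n X"
  shows "\<exists>Y. description_graph n X Y"
proof -
  let ?G = "Gamma n X"
  have X: "X \<in> carrier_mat n n" "X\<^sup>T = X"
    using assms by (auto simp: label_graph_def)
  have dim: "dim_row ?G = n" "dim_col ?G = n"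
    by (simp_all add: Gamma_def)
  have sym: "?G $$ (i, j) = ?G $$ (j, i)" if "i < n" "j < n" for i j
  proof -
    have "(X ^\<^sub>m k) $$ (i, j) = (X ^\<^sub>m k) $$ (j, i)" for k
      using arg_cong[OF transpose_pow_mat[OF X, of k], of "\<lambda>M. M $$ (j, i)"] that X by simp
    then show ?thesis
      using that X by (simp add: Gamma_def)
  qed
  have "elements_mat ?G = (\<lambda>(i, j). ?G $$ (i, j)) ` ({..<n} \<times> {..<n})"
    by (force simp: elements_mat_def dim)
  then have "finite (elements_mat ?G)"
    by simp
  then obtain f :: "rpoly \<Rightarrow> nat" where f: "inj_on f (elements_mat ?G)"
    using finite_imp_inj_to_nat_seg by blast
  define \<sigma> where "\<sigma> = (\<lambda>p. label (Suc (f p)))"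
  define Y where "Y = mat n n (\<lambda>(i, j). \<sigma> (?G $$ (i, j)))"
  have Var: "\<sigma> p \<in> Var" for p
    by (auto simp: \<sigma>_def Var_def)
  have "label_graph n Y"
    using Var sym by (auto simp: label_graph_def Y_def intro!: eq_matI)
  moreover have "equiv_var_subst ?G Y"
    unfolding equiv_var_subst_def
  proof (intro conjI exI[of _ \<sigma>])
    show "inj_on \<sigma> (elements_mat ?G)"
      using f by (auto simp: inj_on_def \<sigma>_def)
  qed (use Var in \<open>auto simp: dim Y_def\<close>)
  ultimately show ?thesis
    by (auto simp: description_graph_def)
qed

lemma equiv_var_subst_imp_mat_equiv:
  assumes "equiv_var_subst A B"
  shows "A \<approx> B"
proof -
  from assms obtain \<sigma> where \<sigma>: "inj_on \<sigma> (elements_mat A)"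
    "\<forall>i<dim_row A. \<forall>j<dim_col A. B $$ (i, j) = \<sigma> (A $$ (i, j))"
    and dim: "dim_row B = dim_row A" "dim_col B = dim_col A"
    by (auto simp: equiv_var_subst_def)
  have "A $$ (i, j) \<in> elements_mat A" if "i < dim_row A" "j < dim_col A" for i j
    using that by (force simp: elements_mat_def)
  then show ?thesis
    using \<sigma> dim by (simp add: mat_equiv_def mat_arrow_def) (metis inj_onD)
qed

lemma mat_equiv_sym: "A \<approx> B \<Longrightarrow> B \<approx> A"
  by (simp add: mat_equiv_def)

lemma mat_equiv_trans: "A \<approx> B \<Longrightarrow> B \<approx> C \<Longrightarrow> A \<approx> C"
  unfolding mat_equiv_def mat_arrow_def by metis

lemma stable_graph_iff:
  assumes "label_graph n X"
  shows "stable_graph n X \<longleftrightarrow> (\<forall>Y. description_graph n X Y \<longrightarrow> Y \<approx> X)"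
proof -
  have "Z \<approx> X" if "description_graph n X Y" "Y \<approx> X" "description_graph n X Z" for Y Z
  proof -
    have "Gamma n X \<approx> Y" "Gamma n X \<approx> Z"
      using that by (auto simp: description_graph_def intro: equiv_var_subst_imp_mat_equiv)
    then have "Z \<approx> Y"
      by (rule mat_equiv_trans[OF mat_equiv_sym, rotated])
    then show ?thesis
      using that(2) by (rule mat_equiv_trans)
  qed
  then show ?thesis
    using description_graph_exists[OF assms] unfolding stable_graph_def by blast
qed

end

theory Submission
  imports Defs
begin

text \<open>For a graph that recognizes vertices, \<open>X \<rightarrowtail> X\<^sup>k\<close> always holds for \<open>k > 0\<close>: the label of a pair
  \<open>(i, j)\<close> can be read off from the monomials of \<open>X\<^sup>k\<close> at \<open>(i, j)\<close> with at most one off-diagonal label.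
  Hence everything reduces to \<open>X\<^sup>2 \<rightarrowtail> X\<close>. This says that the symmetric matrices determined by \<open>X\<close> are
  closed under the Jordan product \<open>X Y + Y X\<close> with \<open>X\<close>, and powers are iterated Jordan products, so it
  implies \<open>X\<^sup>k \<rightarrowtail> X\<close> for all \<open>k\<close>. The powers of \<open>\<lambda>\<close> separate the \<open>X\<^sup>k\<close> in \<open>\<Gamma>(X)\<close>, and \<open>X\<^sup>2\<close> occurs there
  unless \<open>n \<le> 2\<close>, where \<open>X\<^sup>2 \<rightarrowtail> X\<close> holds anyway.\<close>

abbreviation "lookup \<equiv> Poly_Mapping.lookup"
abbreviation "keys \<equiv> Poly_Mapping.keys"
abbreviation "single \<equiv> Poly_Mapping.single"

section \<open>Coefficients and monomials\<close>

lemma lookup_single_mult_add: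
  fixes P :: "'a::cancel_comm_monoid_add \<Rightarrow>\<^sub>0 'b::semiring_0"
  shows "lookup (single a c * P) (a + m) = c * lookup P m"
proof -
  have "lookup (single a c * P) (a + m) =
      (\<Sum>l. (c * (\<Sum>q. lookup P q when a + m = l + q) when l = a))"
    unfolding lookup_mult lookup_single by (rule Sum_any.cong) (auto simp: when_def)
  also have "\<dots> = c * (\<Sum>q. lookup P q when q = m)"
    by (simp add: eq_commute[of m])
  finally show ?thesis
    by simp
qed

lemma keys_single_mult:
  assumes "m \<in> keys (single a c * P)"
  obtains q where "q \<in> keys P" "m = a + q"
proof -
  have "m \<in> {x + q |x q. x \<in> keys (single a c) \<and> q \<in> keys P}"
    using assms keys_mult[of "single a c" P] by blast
  then show ?thesis
    by (auto split: if_splits intro: that)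
qed

lemma lookup_single_mult_nonneg:
  fixes P :: "'a::cancel_comm_monoid_add \<Rightarrow>\<^sub>0 real"
  assumes "\<And>x. 0 \<le> lookup P x" "0 \<le> c"
  shows "0 \<le> lookup (single a c * P) m"
proof (cases "m \<in> keys (single a c * P)")
  case True
  then obtain q where "m = a + q"
    by (rule keys_single_mult)
  then show ?thesis
    using assms by (simp add: lookup_single_mult_add)
qed (simp add: in_keys_iff)

text \<open>The coefficient of \<open>x\<close> counts the indices sent to \<open>x\<close>. Equal
  sums of monomials thus mean equal multisets, so any function of the monomials has the same sum
  over both.\<close>

lemma sum_cong_of_sum_single_eq:
  fixes G :: "'b \<Rightarrow> 'c::semiring_1"
  assumes "finite A"
    and eq: "(\<Sum>l\<in>A. single (p l) (1::real)) = (\<Sum>l\<in>A. single (q l) 1)"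
  shows "(\<Sum>l\<in>A. G (p l)) = (\<Sum>l\<in>A. G (q l))"
proof -
  define T where "T = p ` A \<union> q ` A"
  have "lookup (\<Sum>l\<in>A. single (r l) (1::real)) x = real (card {l \<in> A. r l = x})"
    for r :: "'a \<Rightarrow> 'b" and x
    using \<open>finite A\<close>
    by (simp add: lookup_sum lookup_single when_def sum.If_cases Int_def)
  with eq have card: "card {l \<in> A. p l = x} = card {l \<in> A. q l = x}" for x
    by (metis of_nat_eq_iff)
  have "(\<Sum>l\<in>A. G (r l)) = (\<Sum>x\<in>T. of_nat (card {l \<in> A. r l = x}) * G x)"
    if "r ` A \<subseteq> T" for r
  proof -
    have "(\<Sum>l\<in>A. G (r l)) = (\<Sum>x\<in>T. \<Sum>l\<in>{l \<in> A. r l = x}. G (r l))"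
      using that \<open>finite A\<close> by (intro sum.group[symmetric]) (auto simp: T_def)
    then show ?thesis
      by simp
  qed
  then show ?thesis
    by (simp add: card T_def)
qed

section \<open>Labels as monomials\<close>

definition label_monom :: "nat \<Rightarrow> indet \<Rightarrow>\<^sub>0 nat" where
  "label_monom a = single (Label a) 1"

lemma label_eq_single: "label a = single (label_monom a) 1"
  by (simp add: label_def indet_poly_def label_monom_def)

lemma lookup_label_monom:
  "lookup (label_monom a) v = (if v = Label a then 1 else 0)"
  by (auto simp: label_monom_def lookup_single when_def)

text \<open>Comparing the exponents of \<open>Label a\<close> finds \<open>a\<close> on the right;
  cancelling it leaves the other factor. Labels commute, so the order is lost.\<close>

lemma label_monom_add_eqD:
  assumes "label_monom a + label_monom b = label_monom c + label_monom d"
  shows "a = c \<and> b = d \<or> a = d \<and> b = c"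
proof -
  have inj: "x = y" if "label_monom x = label_monom y" for x y
    using that by (simp add: label_monom_def single_eq_iff)
  have "lookup (label_monom a + label_monom b) (Label a) =
        lookup (label_monom c + label_monom d) (Label a)"
    using assms by simp
  then have "a = c \<or> a = d"
    by (auto simp: lookup_add lookup_label_monom split: if_splits)
  then show ?thesis
  proof
    assume "a = c"
    with assms show ?thesis
      by (simp add: inj)
  next
    assume "a = d"
    with assms show ?thesis
      by (simp add: inj add.commute[of "label_monom c"])
  qed
qed

lemma label_monom_add_single: "label_monom a + single (Label a) k = single (Label a) (Suc k)"
  by (simp add: label_monom_def flip: single_add)

lemma lam_power: "lam ^ k = single (single Lambda k) 1"
  by (induction k)
    (simp_all add: lam_def indet_poly_def mult_single flip: single_add)

section \<open>Graphs given by label indices\<close>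

locale colored_graph =
  fixes n :: nat and X :: "rpoly mat" and c :: "nat \<Rightarrow> nat \<Rightarrow> nat"
  assumes carrier: "X \<in> carrier_mat n n"
    and entry: "\<And>i j. i < n \<Longrightarrow> j < n \<Longrightarrow> X $$ (i, j) = label (c i j)"
    and sym: "\<And>i j. i < n \<Longrightarrow> j < n \<Longrightarrow> c i j = c j i"
    and diag: "\<And>i j k. i < n \<Longrightarrow> j < n \<Longrightarrow> k < n \<Longrightarrow> j \<noteq> k \<Longrightarrow> c i i \<noteq> c j k"
begin

lemma diag_iff:
  assumes "i < n" "j < n" "s < n" "t < n" "c i j = c s t"
  shows "i = j \<longleftrightarrow> s = t"
  using assms diag by metis

lemma arrowI:
  assumes "A \<in> carrier_mat n n" "B \<in> carrier_mat n n"
    and "\<And>i j s t. i < n \<Longrightarrow> j < n \<Longrightarrow> s < n \<Longrightarrow> t < n \<Longrightarrow>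
      B $$ (i, j) = B $$ (s, t) \<Longrightarrow> A $$ (i, j) = A $$ (s, t)"
  shows "A \<rightarrowtail> B"
proof -
  have dim: "dim_row A = n" "dim_col A = n" "dim_row B = n" "dim_col B = n"
    using assms(1,2) by auto
  show ?thesis
    unfolding mat_arrow_def dim by (intro conjI allI impI refl) (rule assms(3))
qed

lemma arrow_XI:
  assumes "A \<in> carrier_mat n n"
    and "\<And>i j s t. i < n \<Longrightarrow> j < n \<Longrightarrow> s < n \<Longrightarrow> t < n \<Longrightarrow>
      c i j = c s t \<Longrightarrow> A $$ (i, j) = A $$ (s, t)"
  shows "A \<rightarrowtail> X"
proof (rule arrowI[OF assms(1) carrier])
  fix i j s t
  assume "i < n" "j < n" "s < n" "t < n" "X $$ (i, j) = X $$ (s, t)"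
  then show "A $$ (i, j) = A $$ (s, t)"
    by (intro assms(2)) (simp_all add: entry)
qed

lemma arrow_XD:
  assumes "A \<rightarrowtail> X" "i < n" "j < n" "s < n" "t < n" "c i j = c s t"
  shows "A $$ (i, j) = A $$ (s, t)"
proof -
  have "X $$ (i, j) = X $$ (s, t)"
    using assms by (simp add: entry)
  moreover have "dim_row A = n" "dim_col A = n"
    using assms(1) carrier unfolding mat_arrow_def by (metis carrier_matD)+
  ultimately show ?thesis
    using assms(1-5) unfolding mat_arrow_def by metis
qed

lemma dim_X [simp]: "dim_row X = n" "dim_col X = n"
  using carrier by auto

lemma pow_carrier: "X ^\<^sub>m k \<in> carrier_mat n n"
  using carrier by simp

lemma dim_pow [simp]: "dim_row (X ^\<^sub>m k) = n" "dim_col (X ^\<^sub>m k) = n"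
  using pow_carrier[of k] by auto

section \<open>Walks and the monomials of powers\<close>

lemma pow_Suc_entry:
  assumes "i < n" "j < n"
  shows "(X ^\<^sub>m Suc k) $$ (i, j) =
    (\<Sum>l<n. single (label_monom (c l j)) 1 * (X ^\<^sub>m k) $$ (i, l))"
  using assms
  by (auto simp: scalar_prod_def entry label_eq_single mult.commute atLeast0LessThan
      intro!: sum.cong)

text \<open>This rules out cancellation between walks: the weight of every walk survives in the
  power.\<close>

lemma pow_lookup_nonneg:
  assumes "i < n" "j < n"
  shows "0 \<le> lookup ((X ^\<^sub>m k) $$ (i, j)) m"
  using assms
proof (induction k arbitrary: j m)
  case 0
  then show ?case
    by (simp add: lookup_one when_def)
next
  case (Suc k)
  then show ?case
    unfolding pow_Suc_entry[OF Suc.prems] lookup_sum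
    by (intro sum_nonneg lookup_single_mult_nonneg) auto
qed

text \<open>With nonnegative coefficients, no other summand can cancel the one passing through
  \<open>l\<close>.\<close>

lemma keys_pow_extend:
  assumes "i < n" "l < n" "j < n" "m \<in> keys ((X ^\<^sub>m k) $$ (i, l))"
  shows "label_monom (c l j) + m \<in> keys ((X ^\<^sub>m Suc k) $$ (i, j))"
proof -
  have "0 < lookup ((X ^\<^sub>m k) $$ (i, l)) m"
    using assms pow_lookup_nonneg[of i l k m] by (simp add: in_keys_iff)
  also have "\<dots> = lookup (single (label_monom (c l j)) 1 * (X ^\<^sub>m k) $$ (i, l))
      (label_monom (c l j) + m)"
    by (simp add: lookup_single_mult_add)
  also have "\<dots> \<le> lookup ((X ^\<^sub>m Suc k) $$ (i, j)) (label_monom (c l j) + m)"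
    unfolding pow_Suc_entry[OF assms(1,3)] lookup_sum
    by (rule member_le_sum) (use assms in \<open>auto intro!: lookup_single_mult_nonneg pow_lookup_nonneg\<close>)
  finally show ?thesis
    by (simp add: in_keys_iff del: pow_mat.simps)
qed

lemma keys_pow_Suc:
  assumes "i < n" "j < n" "m \<in> keys ((X ^\<^sub>m Suc k) $$ (i, j))"
  obtains l q where "l < n" "q \<in> keys ((X ^\<^sub>m k) $$ (i, l))" "m = label_monom (c l j) + q"
proof -
  from assms have "(\<Sum>l<n. lookup (single (label_monom (c l j)) 1 * (X ^\<^sub>m k) $$ (i, l)) m) \<noteq> 0"
    by (simp add: in_keys_iff pow_Suc_entry lookup_sum del: pow_mat.simps)
  then obtain l where "l < n"
    "lookup (single (label_monom (c l j)) 1 * (X ^\<^sub>m k) $$ (i, l)) m \<noteq> 0"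
    by (auto elim: sum.not_neutral_contains_not_neutral)
  then have "m \<in> keys (single (label_monom (c l j)) 1 * (X ^\<^sub>m k) $$ (i, l))"
    by (simp add: in_keys_iff)
  then show ?thesis
    by (rule keys_single_mult) (rule that[OF \<open>l < n\<close>])
qed

definition offdiag :: "nat set" where
  "offdiag = (\<lambda>(i, j). c i j) ` {(i, j). i < n \<and> j < n \<and> i \<noteq> j}"

text \<open>For the weight of a walk this counts the steps that are not loops.\<close>

definition offdeg :: "(indet \<Rightarrow>\<^sub>0 nat) \<Rightarrow> nat" where
  "offdeg m = (\<Sum>a\<in>offdiag. lookup m (Label a))"

lemma finite_offdiag: "finite offdiag"
proof -
  have "{(i, j). i < n \<and> j < n \<and> i \<noteq> j} \<subseteq> {..<n} \<times> {..<n}"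
    by auto
  then show ?thesis
    unfolding offdiag_def by (meson finite_SigmaI finite_imageI finite_lessThan finite_subset)
qed

lemma in_offdiag_iff:
  assumes "i < n" "j < n"
  shows "c i j \<in> offdiag \<longleftrightarrow> i \<noteq> j"
  using assms diag by (force simp: offdiag_def)

lemma offdeg_add: "offdeg (p + q) = offdeg p + offdeg q"
  by (simp add: offdeg_def lookup_add sum.distrib)

lemma offdeg_label_monom:
  assumes "i < n" "j < n"
  shows "offdeg (label_monom (c i j)) = (if i = j then 0 else 1)"
  using in_offdiag_iff[OF assms] finite_offdiag
  by (simp add: offdeg_def lookup_label_monom)

text \<open>The monomials of \<open>X\<^sup>k\<close> are the weights of the walks of length \<open>k\<close>. A walk of off-diagonal
  degree at most \<open>1\<close> consists of loops and at most one edge, which joins its end points.\<close>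

lemma keys_pow:
  assumes "i < n" "j < n" "m \<in> keys ((X ^\<^sub>m k) $$ (i, j))"
  shows "lookup m Lambda = 0
    \<and> (offdeg m = 0 \<longrightarrow> i = j \<and> m = single (Label (c i i)) k)
    \<and> (offdeg m = 1 \<longrightarrow> i \<noteq> j \<and> 0 < lookup m (Label (c i j)))"
  using assms
proof (induction k arbitrary: j m)
  case 0
  then show ?case
    by (auto simp: offdeg_def split: if_splits)
next
  case (Suc k)
  from keys_pow_Suc[OF Suc.prems] obtain l q
    where l: "l < n" and q: "q \<in> keys ((X ^\<^sub>m k) $$ (i, l))"
      and m: "m = label_monom (c l j) + q" .
  note IH = Suc.IH[OF \<open>i < n\<close> l q]
  have deg: "offdeg m = (if l = j then 0 else 1) + offdeg q"
    using l \<open>j < n\<close> by (simp add: m offdeg_add offdeg_label_monom)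
  \<comment> \<open>A final loop changes neither the end point nor the degree. A final edge raises
    the degree by 1, so total degree 1 forces degree 0 before it; then \<open>i = l\<close> and that
    edge joins \<open>i\<close> to \<open>j\<close>.\<close>
  show ?case
  proof (cases "l = j")
    case True
    with IH deg show ?thesis
      by (auto simp: m lookup_add lookup_label_monom label_monom_add_single)
  next
    case False
    with IH deg show ?thesis
      by (auto simp: m lookup_add lookup_label_monom)
  qed
qed

text \<open>The walk that stays at \<open>i\<close> contributes this monomial.\<close>

lemma loop_in_keys_pow:
  assumes "i < n"
  shows "single (Label (c i i)) k \<in> keys ((X ^\<^sub>m k) $$ (i, i))"
proof (induction k)
  case 0
  then show ?case
    using assms by simp
next
  case (Suc k)
  then show ?case
    using keys_pow_extend[OF assms assms assms Suc]
    by (simp add: label_monom_add_single del: pow_mat.simps)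
qed

lemma offdeg_loop:
  assumes "i < n"
  shows "offdeg (single (Label (c i i)) k) = 0"
  using in_offdiag_iff[OF assms assms]
  by (auto simp: offdeg_def lookup_single when_def intro!: sum.neutral)

lemma offdeg_1_unique:
  assumes "offdeg m = 1" "a \<in> offdiag" "b \<in> offdiag"
    and "0 < lookup m (Label a)" "0 < lookup m (Label b)"
  shows "a = b"
proof (rule ccontr)
  assume "a \<noteq> b"
  then have "lookup m (Label a) + lookup m (Label b) = (\<Sum>x\<in>{a, b}. lookup m (Label x))"
    by simp
  also have "\<dots> \<le> offdeg m"
    unfolding offdeg_def using assms finite_offdiag by (intro sum_mono2) auto
  finally show False
    using assms by simp
qed

lemma arrow_pow: "X \<rightarrowtail> X ^\<^sub>m Suc k"
proof (rule arrowI[OF carrier pow_carrier])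
  fix i j s t
  assume that: "i < n" "j < n" "s < n" "t < n"
    and eq: "(X ^\<^sub>m Suc k) $$ (i, j) = (X ^\<^sub>m Suc k) $$ (s, t)"
  have "c i j = c s t"
  proof (cases "i = j")
    case True
    let ?m = "single (Label (c i i)) (Suc k)"
    have "?m \<in> keys ((X ^\<^sub>m Suc k) $$ (s, t))"
      using loop_in_keys_pow[OF that(1), of "Suc k"] True eq by simp
    with keys_pow[OF that(3) that(4)] offdeg_loop[OF that(1)]
    have "s = t" and "?m = single (Label (c s s)) (Suc k)"
      by blast+
    \<comment> \<open>The exponent \<open>Suc k\<close> is nonzero, so equal powers have equal
      labels.\<close>
    with True show ?thesis
      by (simp add: single_eq_iff)
  next
    case False
    \<comment> \<open>The weight of the walk that makes \<open>k\<close> loops at \<open>i\<close>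
      and then steps to \<open>j\<close>.\<close>
    let ?m = "label_monom (c i j) + single (Label (c i i)) k"
    have "?m \<in> keys ((X ^\<^sub>m Suc k) $$ (i, j))"
      using keys_pow_extend[OF _ _ _ loop_in_keys_pow] that by blast
    with eq have key: "?m \<in> keys ((X ^\<^sub>m Suc k) $$ (s, t))"
      by simp
    have deg: "offdeg ?m = 1"
      using that False by (simp add: offdeg_add offdeg_label_monom offdeg_loop)
    have st: "s \<noteq> t" "0 < lookup ?m (Label (c s t))"
      using keys_pow[OF that(3) that(4) key] deg by blast+
    \<comment> \<open>Both \<open>c i j\<close> and \<open>c s t\<close> are off-diagonal labels
      dividing a monomial of off-diagonal degree 1, so they coincide.\<close>
    show ?thesis
      using offdeg_1_unique[OF deg _ _ _ st(2), of "c i j"] that False st(1)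
      by (simp add: in_offdiag_iff lookup_add lookup_label_monom)
  qed
  then show "X $$ (i, j) = X $$ (s, t)"
    using that by (simp add: entry)
qed

section \<open>Jordan products and powers determined by the graph\<close>

text \<open>\<open>X\<^sup>2\<close> only sees the unordered pairs of labels on the walks of length \<open>2\<close>, so \<open>X Y\<close> alone need
  not be determined by \<open>X\<close>; the Jordan product \<open>X Y + Y X\<close> is.\<close>

lemma jordan_product_cong:
  assumes sq: "X ^\<^sub>m 2 \<rightarrowtail> X" and Y: "Y \<rightarrowtail> X" "Y \<in> carrier_mat n n"
    and ij: "i < n" "j < n" and st: "s < n" "t < n" and eq: "c i j = c s t"
  shows "(X * Y) $$ (i, j) + (Y * X) $$ (i, j) = (X * Y) $$ (s, t) + (Y * X) $$ (s, t)"
proof -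
  \<comment> \<open>An entry of \<open>Y\<close> depends only on the label of \<open>X\<close> at
    its place, so it may be read off at an arbitrary position with that label.\<close>
  have "\<exists>f. \<forall>i<n. \<forall>j<n. Y $$ (i, j) = f (c i j)"
  proof (intro exI allI impI)
    fix i j assume ij: "i < n" "j < n"
    define p where "p = (SOME p. fst p < n \<and> snd p < n \<and> c (fst p) (snd p) = c i j)"
    have "fst p < n \<and> snd p < n \<and> c (fst p) (snd p) = c i j"
      unfolding p_def by (rule someI[of _ "(i, j)"]) (use ij in simp)
    then have "Y $$ (i, j) = Y $$ p"
      using arrow_XD[OF Y(1), of i j "fst p" "snd p"] ij by simp
    then show "Y $$ (i, j) =
        (\<lambda>a. Y $$ (SOME p. fst p < n \<and> snd p < n \<and> c (fst p) (snd p) = a)) (c i j)"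
      by (simp add: p_def)
  qed
  then obtain f where f: "\<And>i j. i < n \<Longrightarrow> j < n \<Longrightarrow> Y $$ (i, j) = f (c i j)"
    by blast
  \<comment> \<open>The contribution of a walk of length 2 with labels \<open>a\<close>,
    \<open>b\<close> to both products together; adding them makes it symmetric.\<close>
  define g where "g a b = label a * f b + label b * f a" for a b
  have g_sym: "g a b = g b a" for a b
    by (simp add: g_def add.commute)
  \<comment> \<open>The factorization is unique up to order and \<open>g\<close> is symmetric, so
    the choice does not affect the value on a product of two labels.\<close>
  define G where "G m = (let p = SOME p. m = label_monom (fst p) + label_monom (snd p)
    in g (fst p) (snd p))" for m
  have G: "G (label_monom a + label_monom b) = g a b" for a b
  proof -
    define p where
      "p = (SOME p. label_monom a + label_monom b = label_monom (fst p) + label_monom (snd p))"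
    have "label_monom a + label_monom b = label_monom (fst p) + label_monom (snd p)"
      unfolding p_def by (rule someI[of _ "(a, b)"]) simp
    then have "g (fst p) (snd p) = g a b"
      using label_monom_add_eqD g_sym by metis
    then show ?thesis
      by (simp add: G_def p_def)
  qed
  have prod: "(X * Y) $$ (i, j) + (Y * X) $$ (i, j) =
      (\<Sum>l<n. G (label_monom (c i l) + label_monom (c l j)))" if "i < n" "j < n" for i j
    using that Y(2)
    by (auto simp: scalar_prod_def G g_def entry f atLeast0LessThan mult.commute
        simp flip: sum.distrib intro!: sum.cong)
  have square: "(X ^\<^sub>m 2) $$ (i, j) =
      (\<Sum>l<n. single (label_monom (c i l) + label_monom (c l j)) 1)"
    if "i < n" "j < n" for i j
    using that carrier
    by (auto simp: numeral_2_eq_2 scalar_prod_def entry label_eq_single mult_single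
        atLeast0LessThan intro!: sum.cong)
  have "(X ^\<^sub>m 2) $$ (i, j) = (X ^\<^sub>m 2) $$ (s, t)"
    using sq ij st eq by (rule arrow_XD)
  \<comment> \<open>Both sides sum the same \<open>G\<close> over the monomials that make up the
    entries of the square, and these form equal multisets.\<close>
  then show ?thesis
    unfolding prod[OF ij] prod[OF st] square[OF ij] square[OF st]
    by (rule sum_cong_of_sum_single_eq[OF finite_lessThan,
      where p = "\<lambda>l. label_monom (c i l) + label_monom (c l j)" and
        q = "\<lambda>l. label_monom (c s l) + label_monom (c l t)"])
qed

lemma pow_arrow:
  assumes "X ^\<^sub>m 2 \<rightarrowtail> X"
  shows "X ^\<^sub>m k \<rightarrowtail> X"
proof (induction k)
  case 0
  show ?case
  \<comment> \<open>The identity matrix only distinguishes diagonal from off-diagonal places, and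
    the labels do so too.\<close>
  proof (rule arrow_XI[OF pow_carrier])
    fix i j s t
    assume ij: "i < n" "j < n" "s < n" "t < n" and "c i j = c s t"
    then have "i = j \<longleftrightarrow> s = t"
      by (rule diag_iff)
    with ij show "(X ^\<^sub>m 0) $$ (i, j) = (X ^\<^sub>m 0) $$ (s, t)"
      by simp
  qed
next
  case (Suc k)
  have "(X ^\<^sub>m Suc k) $$ (i, j) = (X ^\<^sub>m Suc k) $$ (s, t)"
    if "i < n" "j < n" "s < n" "t < n" "c i j = c s t" for i j s t
  proof -
    let ?P = "(X ^\<^sub>m Suc k) $$ (i, j)" and ?Q = "(X ^\<^sub>m Suc k) $$ (s, t)"
    \<comment> \<open>Since \<open>X\<close> commutes with its powers, the Jordan product is twice
      the next power; the factor 2 is then cancelled in the real coefficients.\<close>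
    have "X * X ^\<^sub>m k = X ^\<^sub>m Suc k" "X ^\<^sub>m k * X = X ^\<^sub>m Suc k"
      using pow_mat_commute[OF carrier, of k] by simp_all
    then have "?P + ?P = ?Q + ?Q"
      using jordan_product_cong[OF assms Suc pow_carrier that] by (simp only:)
    then have "lookup ?P m + lookup ?P m = lookup ?Q m + lookup ?Q m" for m
      by (simp only: flip: lookup_add)
    then have "lookup ?P m = lookup ?Q m" for m
      by (simp flip: mult_2 del: pow_mat.simps)
    then show ?thesis
      by (rule poly_mapping_eqI)
  qed
  then show ?case
    by (rule arrow_XI[OF pow_carrier])
qed

section \<open>The matrix \<open>Gamma n X\<close>\<close>

lemma Gamma_carrier: "Gamma n X \<in> carrier_mat n n"
  by (simp add: Gamma_def)

lemma Gamma_entry: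
  assumes "i < n" "j < n"
  shows "Gamma n X $$ (i, j) =
    (\<Sum>k<n. single (single Lambda k) 1 * (X ^\<^sub>m k) $$ (i, j))"
  using assms by (simp add: Gamma_def lam_power)

text \<open>Powers of \<open>X\<close> do not involve \<open>Lambda\<close>, so every monomial of
  the summand for \<open>l\<close> has exponent \<open>l\<close> in it. Only the summand for
  \<open>k\<close> can contribute.\<close>

lemma lookup_Gamma:
  assumes "i < n" "j < n" "k < n" "lookup m Lambda = 0"
  shows "lookup (Gamma n X $$ (i, j)) (single Lambda k + m) =
    lookup ((X ^\<^sub>m k) $$ (i, j)) m"
proof -
  let ?m = "single Lambda k + m"
  have "lookup (single (single Lambda l) 1 * (X ^\<^sub>m l) $$ (i, j)) ?m =
      (if l = k then lookup ((X ^\<^sub>m k) $$ (i, j)) m else 0)" for l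
  proof (cases "l = k")
    case False
    have "?m \<notin> keys (single (single Lambda l) 1 * (X ^\<^sub>m l) $$ (i, j))"
    proof
      assume "?m \<in> keys (single (single Lambda l) 1 * (X ^\<^sub>m l) $$ (i, j))"
      then obtain q where "q \<in> keys ((X ^\<^sub>m l) $$ (i, j))"
        "?m = single Lambda l + q"
        by (rule keys_single_mult)
      then have "lookup ?m Lambda = l"
        using keys_pow[OF assms(1,2)] by (simp add: lookup_add)
      then show False
        using False assms(4) by (simp add: lookup_add)
    qed
    then show ?thesis
      using False by (simp add: in_keys_iff)
  qed (simp add: lookup_single_mult_add)
  then show ?thesis
    using assms by (simp add: Gamma_entry lookup_sum)
qed

lemma pow_arrow_Gamma:
  assumes "k < n"
  shows "X ^\<^sub>m k \<rightarrowtail> Gamma n X"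
proof -
  have "(X ^\<^sub>m k) $$ (i, j) = (X ^\<^sub>m k) $$ (s, t)"
    if "i < n" "j < n" "s < n" "t < n" "Gamma n X $$ (i, j) = Gamma n X $$ (s, t)" for i j s t
  proof (rule poly_mapping_eqI)
    fix m
    show "lookup ((X ^\<^sub>m k) $$ (i, j)) m = lookup ((X ^\<^sub>m k) $$ (s, t)) m"
    proof (cases "lookup m Lambda = 0")
      case True
      then show ?thesis
        using that assms by (simp flip: lookup_Gamma)
    next
      case False
      then have "m \<notin> keys ((X ^\<^sub>m k) $$ (i, j))" "m \<notin> keys ((X ^\<^sub>m k) $$ (s, t))"
        using keys_pow[OF that(1,2)] keys_pow[OF that(3,4)] by auto
      then show ?thesis
        by (simp add: in_keys_iff)
    qed
  qed
  then show ?thesis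
    by (rule arrowI[OF pow_carrier Gamma_carrier])
qed

lemma Gamma_arrow:
  assumes "\<And>k. X ^\<^sub>m k \<rightarrowtail> X"
  shows "Gamma n X \<rightarrowtail> X"
proof (rule arrow_XI[OF Gamma_carrier])
  fix i j s t
  assume ij: "i < n" "j < n" "s < n" "t < n" "c i j = c s t"
  then have "(X ^\<^sub>m k) $$ (i, j) = (X ^\<^sub>m k) $$ (s, t)" for k
    using arrow_XD[OF assms] by blast
  with ij show "Gamma n X $$ (i, j) = Gamma n X $$ (s, t)"
    by (simp add: Gamma_entry)
qed

text \<open>For order 2, a diagonal entry of the square is the squared loop label plus the squared
  label of the only edge, so equal loops give equal entries; the two off-diagonal entries agree by
  symmetry.\<close>

lemma square_arrow_of_order_le_2:
  assumes "n \<le> 2"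
  shows "X ^\<^sub>m 2 \<rightarrowtail> X"
proof -
  have "(X ^\<^sub>m 2) $$ (i, j) = (X ^\<^sub>m 2) $$ (s, t)"
    if "i < n" "j < n" "s < n" "t < n" "c i j = c s t" for i j s t
  proof -
    consider "n = 1" | "n = 2"
      using assms \<open>i < n\<close> by linarith
    then show ?thesis
    proof cases
      case 1
      then show ?thesis
        using that by simp
    next
      case 2
      have eq: "i = j \<longleftrightarrow> s = t"
        using that by (rule diag_iff)
      have "i \<in> {0, 1}" "j \<in> {0, 1}" "s \<in> {0, 1}" "t \<in> {0, 1}"
        using that 2 by auto
      then show ?thesis
        using that(5) eq 2 carrier sym[of 0 1]
        by (auto simp: numeral_2_eq_2 scalar_prod_def entry mult.commute add.commute)
    qed
  qed
  then show ?thesis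
    by (rule arrow_XI[OF pow_carrier])
qed

lemma arrow_of_order_le_1:
  assumes "n \<le> 1" "A \<in> carrier_mat n n" "B \<in> carrier_mat n n"
  shows "A \<rightarrowtail> B"
  using assms(2,3)
proof (rule arrowI)
  fix i j s t
  assume "i < n" "j < n" "s < n" "t < n"
  with assms(1) have "i = 0" "j = 0" "s = 0" "t = 0"
    by auto
  then show "A $$ (i, j) = A $$ (s, t)"
    by simp
qed

lemma square_arrow_iff_Gamma: "X ^\<^sub>m 2 \<rightarrowtail> X \<longleftrightarrow> Gamma n X \<approx> X"
proof
  assume "X ^\<^sub>m 2 \<rightarrowtail> X"
  then have "Gamma n X \<rightarrowtail> X"
    by (intro Gamma_arrow) (rule pow_arrow)
  moreover have "X \<rightarrowtail> Gamma n X"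
  \<comment> \<open>The sum \<open>Gamma n X\<close> reaches the first power only for
    \<open>n > 1\<close>; smaller matrices have at most one entry.\<close>
  proof (cases "n \<le> 1")
    case True
    then show ?thesis
      by (intro arrow_of_order_le_1 carrier Gamma_carrier)
  next
    case False
    then show ?thesis
      using pow_arrow_Gamma[of 1] carrier by simp
  qed
  ultimately show "Gamma n X \<approx> X"
    by (simp add: mat_equiv_def)
next
  assume *: "Gamma n X \<approx> X"
  show "X ^\<^sub>m 2 \<rightarrowtail> X"
  proof (cases "n \<le> 2")
    case True
    then show ?thesis
      by (rule square_arrow_of_order_le_2)
  next
    case False
    then have "X ^\<^sub>m 2 \<rightarrowtail> Gamma n X"
      by (intro pow_arrow_Gamma) simp
    with * show ?thesis
      unfolding mat_equiv_def mat_arrow_def by metis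
  qed
qed

lemma equiv_pow_iff: "X \<approx> X ^\<^sub>m Suc k \<longleftrightarrow> X ^\<^sub>m Suc k \<rightarrowtail> X"
  using arrow_pow by (simp add: mat_equiv_def)

end

section \<open>Stability and the equivalences\<close>

lemma colored_graph_exists:
  assumes "label_graph n X" "recognizes_vertices X"
  obtains c where "colored_graph n X c"
proof -
  have X: "X \<in> carrier_mat n n" "X\<^sup>T = X"
    and "\<forall>i j. i < n \<longrightarrow> j < n \<longrightarrow> (\<exists>a. X $$ (i, j) = label a)"
    using assms(1) by (auto simp: label_graph_def Var_def)
  then obtain c where c: "\<And>i j. i < n \<Longrightarrow> j < n \<Longrightarrow> X $$ (i, j) = label (c i j)"
    by metis
  have "X $$ (i, j) = X $$ (j, i)" if "i < n" "j < n" for i j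
    using X that by (metis carrier_matD index_transpose_mat(1))
  moreover have "X $$ (i, i) \<noteq> X $$ (j, k)" if "i < n" "j < n" "k < n" "j \<noteq> k" for i j k
    using assms(2) X(1) that by (simp add: recognizes_vertices_def)
  ultimately have "colored_graph n X c"
    using X(1) c by unfold_locales (metis label_eq_iff)+
  then show ?thesis
    by (rule that)
qed

text \<open>A description graph exists, and each one has the same coincidences of entries as
  \<open>Gamma n X\<close>, so the chosen variables drop out.\<close>

lemma stable_graph_iff_Gamma:
  assumes "label_graph n X"
  shows "stable_graph n X \<longleftrightarrow> Gamma n X \<approx> X"
proof -
  have "Gamma n X \<approx> Y" if "description_graph n X Y" for Y
    using that by (auto simp: description_graph_def intro: equiv_var_subst_imp_mat_equiv)
  then show ?thesis
    using description_graph_exists[OF assms] unfolding stable_graph_def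
    by (meson mat_equiv_sym mat_equiv_trans)
qed

theorem theorem2:
  fixes n :: nat and X :: "rpoly mat"
  assumes "label_graph n X" and "recognizes_vertices X"
  shows "(stable_graph n X \<longleftrightarrow> X \<approx> X ^\<^sub>m 2) \<and>
         (X \<approx> X ^\<^sub>m 2 \<longleftrightarrow> (\<forall>l::nat. l > 1 \<longrightarrow> X \<approx> X ^\<^sub>m l))"
proof -
  obtain c where "colored_graph n X c"
    using colored_graph_exists[OF assms] .
  then interpret colored_graph n X c .
  \<comment> \<open>The arrow from \<open>X\<close> to a positive power is automatic;
    \<open>l - 1\<close> brings the exponent into the form \<open>Suc k\<close>.\<close>
  have equiv: "X \<approx> X ^\<^sub>m l \<longleftrightarrow> X ^\<^sub>m l \<rightarrowtail> X" if "l > 1" for l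
    using equiv_pow_iff[of "l - 1"] that by simp
  have "stable_graph n X \<longleftrightarrow> X ^\<^sub>m 2 \<rightarrowtail> X"
    using stable_graph_iff_Gamma[OF assms(1)] square_arrow_iff_Gamma by blast
  moreover have "X ^\<^sub>m 2 \<rightarrowtail> X \<longleftrightarrow> (\<forall>l>1. X ^\<^sub>m l \<rightarrowtail> X)"
    using pow_arrow by auto
  ultimately show ?thesis
    by (simp add: equiv)
qed

end
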